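(* The defining relation $$w^2-\tfrac1{27}w_1+\tfrac29w_2-\tfrac4{15}w_3'-\tfrac1{90}w_3''-\tfrac13w_4+\tfrac23w_5+\tfrac13w_6+\tfrac4{27}w_7=0$$ of the algebra of invariants $\mathbb{C}[\mathcal{M}_3\times\mathcal{M}_3]^{\mathrm{GL}_3}$ coincides with $$w^2+\frac{4v^3}{27}-\frac1{27}(r_3r_5-r_4^2)-\frac1{18}\left(a_3r_1^2-2a_4r_1r_2+a_5r_2^2\right)=0,$$ that is, the left-hand sides of these two equations are equal (as polynomials in $a_3,\dots,a_9,v,w$). Here $w_1,w_2,w_3',w_3'',w_4,\dots,w_7$ and $r_1,\dots,r_5$ are the polynomials in $a_3,\dots,a_9,v$ specified in the context.
   Context: $\mathcal{M}_3$ is the algebra of complex $3\times3$ matrices and $\mathrm{GL}_3=\mathrm{GL}_3(\mathbb{C})$ acts on pairs $(X,Y)\in\mathcal{M}_3\times\mathcal{M}_3$ by simultaneous conjugation. Put $A=X-\frac13\mathrm{Tr}(X)I_3$, $B=Y-\frac13\mathrm{Tr}(Y)I_3$ and $a_1=\mathrm{Tr}(X)$, $a_2=\mathrm{Tr}(Y)$, $a_3=\mathrm{Tr}(A^2)$, $a_4=\mathrm{Tr}(AB)$, $a_5=\mathrm{Tr}(B^2)$, $a_6=\mathrm{Tr}(A^3)$, $a_7=\mathrm{Tr}(A^2B)$, $a_8=\mathrm{Tr}(AB^2)$, $a_9=\mathrm{Tr}(B^3)$, $v=\mathrm{Tr}(A^2B^2)-\mathrm{Tr}(ABAB)$, $w=\mathrm{Tr}(A^2B^2AB)-\mathrm{Tr}(A^2BAB^2)$.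 It is known (Aslaksen, Drensky, Sadikova) that $a_1,\dots,a_9,v,w$ generate $\mathbb{C}[\mathcal{M}_3\times\mathcal{M}_3]^{\mathrm{GL}_3}$ subject to the single defining relation given by the first displayed equation of the claim, in which $u=a_3a_5-a_4^2$, $$D=\begin{vmatrix} a_3 & a_4 & a_5 \\ a_6 & a_7 & a_8 \\ a_7 & a_8 & a_9 \end{vmatrix},$$ $w_1=u^3$, $w_2=u^2v$, $w_4=uv^2$, $w_7=v^3$, $w_5=vD$, $w_3'=uD$, $w_6=(a_6a_9-a_7a_8)^2-4(a_7a_9-a_8^2)(a_6a_8-a_7^2)$, $$\begin{aligned} w_3''={}&5(a_5^3a_6^2+a_3^3a_9^2)-30(a_5^2a_4a_6a_7+a_3^2a_4a_8a_9)-2(2a_4^3+3a_3a_4a_5)(9a_7a_8+a_6a_9) \\ &+3(4a_5a_4^2+a_5^2a_3)(3a_7^2+2a_6a_8)+3(4a_4^2a_3+a_3^2a_5)(3a_8^2+2a_7a_9). \end{aligned}$$ The polynomials $r_i$ are $r_1=a_3a_9-2a_4a_8+a_5a_7$, $r_2=a_3a_8-2a_4a_7+a_5a_6$, $r_3=a_3(a_3a_5-a_4^2-3v)+6(a_6a_8-a_7^2)$, $r_4=a_4(a_3a_5-a_4^2-3v)+3(a_6a_9-a_7a_8)$, $r_5=a_5(a_3a_5-a_4^2-3v)+6(a_7a_9-a_8^2)$. *)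

theory Defs
  imports "HOL-Analysis.Determinants" "HOL-Library.Poly_Mapping"
begin

datatype inv_gen = A3 | A4 | A5 | A6 | A7 | A8 | A9 | V | W

text \<open>
  The polynomial ring over the complex numbers in the nine independent indeterminates
  \<open>a3, \<dots>, a9, v, w\<close>: finitely supported functions from monomials (exponent vectors) to
  coefficients, multiplied by convolution.  The indeterminates stand for the trace invariants
  of the two traceless matrices \<open>A = X - (Tr X / 3) I\<close> and \<open>B = Y - (Tr Y / 3) I\<close>:
  \<open>a3 = Tr A^2\<close>, \<open>a4 = Tr AB\<close>, \<open>a5 = Tr B^2\<close>, \<open>a6 = Tr A^3\<close>, \<open>a7 = Tr A^2 B\<close>, \<open>a8 = Tr A B^2\<close>,
  \<open>a9 = Tr B^3\<close>, \<open>v = Tr A^2 B^2 - Tr ABAB\<close>, \<open>w = Tr A^2 B^2 AB - Tr A^2 B A B^2\<close>.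
  The remaining generators \<open>a1 = Tr X\<close> and \<open>a2 = Tr Y\<close> do not occur in the defining relation.
\<close>

type_synonym inv_poly = "(inv_gen \<Rightarrow>\<^sub>0 nat) \<Rightarrow>\<^sub>0 complex"

definition Const :: "complex \<Rightarrow> inv_poly"
  where "Const c = Poly_Mapping.single 0 c"

definition Var :: "inv_gen \<Rightarrow> inv_poly"
  where "Var x = Poly_Mapping.single (Poly_Mapping.single x 1) 1"

definition a3 :: inv_poly where "a3 = Var A3"
definition a4 :: inv_poly where "a4 = Var A4"
definition a5 :: inv_poly where "a5 = Var A5"
definition a6 :: inv_poly where "a6 = Var A6"
definition a7 :: inv_poly where "a7 = Var A7"
definition a8 :: inv_poly where "a8 = Var A8"
definition a9 :: inv_poly where "a9 = Var A9"
definition v :: inv_poly where "v = Var V"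
definition w :: inv_poly where "w = Var W"

definition u :: inv_poly
  where "u = a3 * a5 - a4^2"

definition D :: inv_poly
  where "D = det (vector [vector [a3, a4, a5],
                          vector [a6, a7, a8],
                          vector [a7, a8, a9]] :: inv_poly ^ 3 ^ 3)"

definition w1 :: inv_poly where "w1 = u^3"
definition w2 :: inv_poly where "w2 = u^2 * v"
definition w3' :: inv_poly where "w3' = u * D"

definition w3'' :: inv_poly
  where "w3'' = 5 * (a5^3 * a6^2 + a3^3 * a9^2)
    - 30 * (a5^2 * a4 * a6 * a7 + a3^2 * a4 * a8 * a9)
    - 2 * (2 * a4^3 + 3 * a3 * a4 * a5) * (9 * a7 * a8 + a6 * a9)
    + 3 * (4 * a5 * a4^2 + a5^2 * a3) * (3 * a7^2 + 2 * a6 * a8)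
    + 3 * (4 * a4^2 * a3 + a3^2 * a5) * (3 * a8^2 + 2 * a7 * a9)"

definition w4 :: inv_poly where "w4 = u * v^2"
definition w5 :: inv_poly where "w5 = v * D"

definition w6 :: inv_poly
  where "w6 = (a6 * a9 - a7 * a8)^2 - 4 * (a7 * a9 - a8^2) * (a6 * a8 - a7^2)"

definition w7 :: inv_poly where "w7 = v^3"

definition r1 :: inv_poly
  where "r1 = a3 * a9 - 2 * a4 * a8 + a5 * a7"

definition r2 :: inv_poly
  where "r2 = a3 * a8 - 2 * a4 * a7 + a5 * a6"

definition r3 :: inv_poly
  where "r3 = a3 * (a3 * a5 - a4^2 - 3 * v) + 6 * (a6 * a8 - a7^2)"

definition r4 :: inv_poly
  where "r4 = a4 * (a3 * a5 - a4^2 - 3 * v) + 3 * (a6 * a9 - a7 * a8)"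

definition r5 :: inv_poly
  where "r5 = a5 * (a3 * a5 - a4^2 - 3 * v) + 6 * (a7 * a9 - a8^2)"

end

theory Submission
  imports Defs
begin

lemma Const_mult: "Const (a * b) = Const a * Const b"
  by (simp add: Const_def mult_single)

lemma Const_numeral: "Const (numeral k) = numeral k"
  by (simp add: Const_def)

text \<open>Comparing rational coefficients such as \<open>10 * Const (1/270)\<close> and
  \<open>Const (1/27)\<close> thus becomes arithmetic in the complex numbers.\<close>

lemma numeral_mult_Const: "numeral k * Const c = Const (numeral k * c)"
  by (simp add: Const_mult Const_numeral)

text \<open>The element \<open>c\<close> stands for the constant \<open>1/270\<close>, of which every coefficient of the
  relation is an integer multiple: this makes the claim an identity over any commutative ring.\<close>

lemma relation_identity:
  fixes a3 a4 a5 a6 a7 a8 a9 u v w D r1 r2 r3 r4 r5 c :: "'a::comm_ring_1"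
  defines "u \<equiv> a3 * a5 - a4^2"
    and "D \<equiv> a3 * (a7 * a9 - a8^2) - a4 * (a6 * a9 - a7 * a8) + a5 * (a6 * a8 - a7^2)"
  defines "r1 \<equiv> a3 * a9 - 2 * a4 * a8 + a5 * a7"
    and "r2 \<equiv> a3 * a8 - 2 * a4 * a7 + a5 * a6"
    and "r3 \<equiv> a3 * (a3 * a5 - a4^2 - 3 * v) + 6 * (a6 * a8 - a7^2)"
    and "r4 \<equiv> a4 * (a3 * a5 - a4^2 - 3 * v) + 3 * (a6 * a9 - a7 * a8)"
    and "r5 \<equiv> a5 * (a3 * a5 - a4^2 - 3 * v) + 6 * (a7 * a9 - a8^2)"
  shows "w^2 - 10 * c * u^3 + 60 * c * (u^2 * v) - 72 * c * (u * D)
      - 3 * c * (5 * (a5^3 * a6^2 + a3^3 * a9^2)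
        - 30 * (a5^2 * a4 * a6 * a7 + a3^2 * a4 * a8 * a9)
        - 2 * (2 * a4^3 + 3 * a3 * a4 * a5) * (9 * a7 * a8 + a6 * a9)
        + 3 * (4 * a5 * a4^2 + a5^2 * a3) * (3 * a7^2 + 2 * a6 * a8)
        + 3 * (4 * a4^2 * a3 + a3^2 * a5) * (3 * a8^2 + 2 * a7 * a9))
      - 90 * c * (u * v^2) + 180 * c * (v * D)
      + 90 * c * ((a6 * a9 - a7 * a8)^2 - 4 * (a7 * a9 - a8^2) * (a6 * a8 - a7^2))
      + 40 * c * v^3
    = w^2 + 40 * c * v^3 - 10 * c * (r3 * r5 - r4^2)
      - 15 * c * (a3 * r1^2 - 2 * a4 * r1 * r2 + a5 * r2^2)"
  \<comment> \<open>With \<open>c\<close> as a formal element all coefficients are integers, so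
    expanding both sides into monomials decides the equality.\<close>
  unfolding assms by (simp add: algebra_simps power2_eq_square power3_eq_cube)

theorem theorem4p1:
  shows "w^2 - Const (1/27) * w1 + Const (2/9) * w2 - Const (4/15) * w3' - Const (1/90) * w3''
           - Const (1/3) * w4 + Const (2/3) * w5 + Const (1/3) * w6 + Const (4/27) * w7
       = w^2 + Const (4/27) * v^3 - Const (1/27) * (r3 * r5 - r4^2)
           - Const (1/18) * (a3 * r1^2 - 2 * a4 * r1 * r2 + a5 * r2^2)"
proof -
  \<comment> \<open>270 is the least common multiple of the denominators 27, 9, 15, 90, 3 and
    18.\<close>
  define c where "c = Const (1/270)"
  have coeffs: "Const (1/27) = 10 * c" "Const (2/9) = 60 * c" "Const (4/15) = 72 * c"
    "Const (1/90) = 3 * c" "Const (1/3) = 90 * c" "Const (2/3) = 180 * c"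
    "Const (4/27) = 40 * c" "Const (1/18) = 15 * c"
    unfolding c_def by (simp_all add: numeral_mult_Const)
  \<comment> \<open>Cofactor expansion along the first row, the shape of \<open>D\<close> in
    \<open>relation_identity\<close>.\<close>
  have det: "D = a3 * (a7 * a9 - a8^2) - a4 * (a6 * a9 - a7 * a8) + a5 * (a6 * a8 - a7^2)"
    by (simp add: D_def det_3 algebra_simps power2_eq_square)
  show ?thesis
    \<comment> \<open>The indeterminates \<open>a3\<close> to \<open>a9\<close>, \<open>v\<close>
      and \<open>w\<close> stay folded: they instantiate the arbitrary ring elements of the
      identity.\<close>
    unfolding coeffs w1_def w2_def w3'_def w3''_def w4_def w5_def w6_def w7_def
      r1_def r2_def r3_def r4_def r5_def det u_def
    by (rule relation_identity)
qed

end
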